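(* Let $(\gamma^{(k)})_{k\ge 0}$ be a sequence in $\mathbb{R}^n_{++}$ such that $x^{(k)}:=\mu(\gamma^{(k)})$ satisfies $x^{(k)}_i\neq 0$ for all $1\le i\le n$ and all $k\ge 0$. Then the iteration scheme $$\gamma^{(k+1)}=\mathop{\arg\min}_{\gamma\in\mathbb{R}^n_{++}} F(x^{(k)},\gamma)+\tilde g_{\mathrm{CB}}(\gamma,\gamma^{(k)}),\qquad k\ge 0,$$ is equivalent to the convex bounding (CB) algorithm $$\gamma^{(k+1)}_i=\gamma_i^{(k)}\sqrt{\frac{[\mu(\gamma^{(k)})]_i^2}{\gamma_i^{(k)}-[\Sigma(\gamma^{(k)})]_{ii}}},\qquad 1\le i\le n,\ k\ge 0;$$ that is, $(\gamma^{(k)})$ satisfies the first recursion for every $k$ (meaning $\gamma^{(k+1)}$ is the unique minimizer) if and only if it satisfies the second recursion for every $k$, so that from the same initial estimate $\gamma^{(0)}$ both generate the same sequence.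
   Context: Setting: $\mathsf F\in\mathbb{R}^{m\times n}$ is a given matrix, $y\in\mathbb{R}^m$, $\beta>0$. $\mathbb{R}^n_{++}=\{u\in\mathbb{R}^n:u_i>0\ \forall i\}$. For $\gamma\in\mathbb{R}^n_{++}$ let $\Gamma=\operatorname{diag}(\gamma)$, $S(\gamma)=\beta^{-1}I+\mathsf F\Gamma\mathsf F^{T}$, $\mu(\gamma)=\Gamma\mathsf F^{T}S(\gamma)^{-1}y\in\mathbb{R}^n$, and $\Sigma(\gamma)=\Gamma-\Gamma\mathsf F^{T}S(\gamma)^{-1}\mathsf F\Gamma$. For $x\in\mathbb{R}^n$, $\gamma\in\mathbb{R}^n_{++}$, $$F(x,\gamma)=\beta\|\mathsf Fx-y\|^2+\sum_{i=1}^n\frac{x_i^2}{\gamma_i}.$$ The CB surrogate function is, for $\gamma,\gamma^{(k)}\in\mathbb{R}^n_{++}$, $$\tilde g_{\mathrm{CB}}(\gamma,\gamma^{(k)})=\log\det S(\gamma^{(k)})+\sum_{i=1}^n\Big((\gamma_i^{(k)})^{-1}-(\gamma_i^{(k)})^{-2}[\Sigma(\gamma^{(k)})]_{ii}\Big)\big(\gamma_i-\gamma_i^{(k)}\big).$$ *)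

theory Defs
  imports "HOL-Analysis.Analysis"
begin

definition pos_orthant :: "(real ^ 'n) set" where
  "pos_orthant = {u. \<forall>i. u $ i > 0}"

definition diag_mat :: "real ^ 'n \<Rightarrow> real ^ 'n ^ 'n" where
  "diag_mat \<gamma> = (\<chi> i j. if i = j then \<gamma> $ i else 0)"

text \<open>An \<open>m \<times> n\<close> matrix has type \<^typ>\<open>real ^ 'n ^ 'm\<close> (rows indexed by \<^typ>\<open>'m\<close>).
  \<open>S\<close> is positive definite for \<open>\<beta> > 0\<close> and \<open>\<gamma>\<close> in the positive orthant, so
  \<open>matrix_inv\<close> below is the genuine inverse.\<close>

definition S_mat :: "real ^ 'n ^ 'm \<Rightarrow> real \<Rightarrow> real ^ 'n \<Rightarrow> real ^ 'm ^ 'm" where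
  "S_mat A \<beta> \<gamma> = inverse \<beta> *\<^sub>R mat 1 + A ** diag_mat \<gamma> ** transpose A"

definition \<mu>_vec :: "real ^ 'n ^ 'm \<Rightarrow> real ^ 'm \<Rightarrow> real \<Rightarrow> real ^ 'n \<Rightarrow> real ^ 'n" where
  "\<mu>_vec A y \<beta> \<gamma> = (diag_mat \<gamma> ** transpose A ** matrix_inv (S_mat A \<beta> \<gamma>)) *v y"

definition \<Sigma>_mat :: "real ^ 'n ^ 'm \<Rightarrow> real \<Rightarrow> real ^ 'n \<Rightarrow> real ^ 'n ^ 'n" where
  "\<Sigma>_mat A \<beta> \<gamma> = diag_mat \<gamma>
     - diag_mat \<gamma> ** transpose A ** matrix_inv (S_mat A \<beta> \<gamma>) ** A ** diag_mat \<gamma>"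

definition F_obj :: "real ^ 'n ^ 'm \<Rightarrow> real ^ 'm \<Rightarrow> real \<Rightarrow> real ^ 'n \<Rightarrow> real ^ 'n \<Rightarrow> real" where
  "F_obj A y \<beta> x \<gamma> = \<beta> * (norm (A *v x - y))\<^sup>2 + (\<Sum>i\<in>UNIV. (x $ i)\<^sup>2 / \<gamma> $ i)"

definition g_CB :: "real ^ 'n ^ 'm \<Rightarrow> real \<Rightarrow> real ^ 'n \<Rightarrow> real ^ 'n \<Rightarrow> real" where
  "g_CB A \<beta> \<gamma> \<gamma>k = ln (det (S_mat A \<beta> \<gamma>k))
     + (\<Sum>i\<in>UNIV. (inverse (\<gamma>k $ i) - inverse ((\<gamma>k $ i)\<^sup>2) * \<Sigma>_mat A \<beta> \<gamma>k $ i $ i)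
                   * (\<gamma> $ i - \<gamma>k $ i))"

definition is_unique_arg_min_on :: "('a \<Rightarrow> real) \<Rightarrow> 'a set \<Rightarrow> 'a \<Rightarrow> bool" where
  "is_unique_arg_min_on f D x \<longleftrightarrow>
     is_arg_min f (\<lambda>z. z \<in> D) x \<and> (\<forall>z. is_arg_min f (\<lambda>z. z \<in> D) z \<longrightarrow> z = x)"

definition surrogate_iteration ::
  "real ^ 'n ^ 'm \<Rightarrow> real ^ 'm \<Rightarrow> real \<Rightarrow> (nat \<Rightarrow> real ^ 'n) \<Rightarrow> bool" where
  "surrogate_iteration A y \<beta> \<gamma> \<longleftrightarrow>
     (\<forall>k. is_unique_arg_min_on
            (\<lambda>g. F_obj A y \<beta> (\<mu>_vec A y \<beta> (\<gamma> k)) g + g_CB A \<beta> g (\<gamma> k))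
            pos_orthant (\<gamma> (Suc k)))"

definition CB_iteration ::
  "real ^ 'n ^ 'm \<Rightarrow> real ^ 'm \<Rightarrow> real \<Rightarrow> (nat \<Rightarrow> real ^ 'n) \<Rightarrow> bool" where
  "CB_iteration A y \<beta> \<gamma> \<longleftrightarrow>
     (\<forall>k i. \<gamma> (Suc k) $ i =
        \<gamma> k $ i * sqrt ((\<mu>_vec A y \<beta> (\<gamma> k) $ i)\<^sup>2
                        / (\<gamma> k $ i - \<Sigma>_mat A \<beta> (\<gamma> k) $ i $ i)))"

end

theory Submission
  imports Defs
begin

text \<open>
  With \<open>a\<^sub>i\<close> the \<open>i\<close>-th column of \<open>A\<close> and \<open>q\<^sub>i = a\<^sub>i\<^sup>T S\<^sup>-\<^sup>1 a\<^sub>i\<close>, one has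
  \<open>\<gamma>\<^sub>i - \<Sigma>\<^sub>i\<^sub>i = \<gamma>\<^sub>i\<^sup>2 q\<^sub>i\<close>, so that \<open>q\<^sub>i\<close> is also the slope of the linear surrogate.
  Up to a constant the surrogate objective is therefore the separable function
  \<open>\<Sum>\<^sub>i (x\<^sub>i\<^sup>2 / \<gamma>\<^sub>i + q\<^sub>i \<gamma>\<^sub>i)\<close>, whose unique minimizer is \<open>\<gamma>\<^sub>i = sqrt (x\<^sub>i\<^sup>2 / q\<^sub>i)\<close>.
  The slope is positive because \<open>S\<^sup>-\<^sup>1\<close> is positive definite and \<open>x\<^sub>i \<noteq> 0\<close> forces \<open>a\<^sub>i \<noteq> 0\<close>.
\<close>

lemma diag_mat_mult_nth: "(diag_mat g ** B) $ i $ j = g $ i * B $ i $ j"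
  by (simp add: matrix_matrix_mult_def diag_mat_def if_distrib [of "\<lambda>x. x * _"] cong: if_cong)

lemma mult_diag_mat_nth: "(B ** diag_mat g) $ i $ j = B $ i $ j * g $ j"
  by (simp add: matrix_matrix_mult_def diag_mat_def if_distrib [of "\<lambda>x. _ * x"] cong: if_cong)

lemma diag_mat_mult_vec_nth: "(diag_mat g *v v) $ i = g $ i * v $ i"
  by (simp add: matrix_vector_mult_def diag_mat_def if_distrib [of "\<lambda>x. x * _"] cong: if_cong)

lemma transpose_mult_vec_nth: "(transpose A *v v) $ i = column i A \<bullet> (v :: real ^ 'm)"
  by (simp add: matrix_vector_mult_def transpose_def column_def inner_vec_def)

lemma transpose_mult_mult_nth:
  fixes A :: "real ^ 'n ^ 'm" and B :: "real ^ 'm ^ 'm"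
  shows "(transpose A ** B ** A) $ i $ j = column i A \<bullet> (B *v column j A)"
proof -
  have "(transpose A ** B ** A) $ i $ j = (transpose A *v (B *v column j A)) $ i"
    unfolding matrix_vector_mul_assoc
    by (simp add: matrix_matrix_mult_def [of _ A] matrix_vector_mult_def [of "_ ** _"] column_def)
  then show ?thesis
    by (simp only: transpose_mult_vec_nth)
qed

text \<open>The form splits into \<open>v \<bullet> v / \<beta>\<close>, which is strictly positive,
  and a sum of squares of the entries of \<open>transpose A *v v\<close> with weights
  \<open>g $ i\<close>.\<close>

lemma S_mat_pos_def:
  fixes A :: "real ^ 'n ^ 'm"
  assumes "\<beta> > 0" "g \<in> pos_orthant" "v \<noteq> 0"
  shows "v \<bullet> (S_mat A \<beta> g *v v) > 0"
proof -
  have "v \<bullet> ((A ** diag_mat g ** transpose A) *v v)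
      = (transpose A *v v) \<bullet> (diag_mat g *v (transpose A *v v))"
    by (simp add: matrix_vector_mul_assoc [symmetric] dot_lmul_matrix [symmetric])
  also have "\<dots> = (\<Sum>i\<in>UNIV. g $ i * ((transpose A *v v) $ i)\<^sup>2)"
    by (simp add: inner_vec_def diag_mat_mult_vec_nth power2_eq_square ac_simps)
  also have "\<dots> \<ge> 0"
    using assms(2) by (intro sum_nonneg mult_nonneg_nonneg) (auto simp: pos_orthant_def less_imp_le)
  finally have "v \<bullet> ((A ** diag_mat g ** transpose A) *v v) \<ge> 0" .
  moreover have "v \<bullet> ((inverse \<beta> *\<^sub>R mat 1) *v v) > 0"
    using assms(1,3) by (simp add: scaleR_matrix_vector_assoc [symmetric])
  ultimately show ?thesis
    by (simp add: S_mat_def matrix_vector_mult_add_rdistrib inner_add_right)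
qed

text \<open>Positive definiteness makes the kernel trivial, hence the square matrix invertible; only
  then does the choice in \<open>matrix_inv\<close> yield an inverse.\<close>

lemma S_mat_mult_matrix_inv:
  fixes A :: "real ^ 'n ^ 'm"
  assumes "\<beta> > 0" "g \<in> pos_orthant"
  shows "S_mat A \<beta> g ** matrix_inv (S_mat A \<beta> g) = mat 1"
proof -
  have "\<forall>v. S_mat A \<beta> g *v v = 0 \<longrightarrow> v = 0"
    using S_mat_pos_def [OF assms] by (metis inner_zero_right less_irrefl)
  then have "invertible (S_mat A \<beta> g)"
    by (simp add: invertible_left_inverse matrix_left_invertible_ker)
  then show ?thesis
    unfolding invertible_def matrix_inv_def by (metis (mono_tags, lifting) someI_ex)
qed

text \<open>Substituting \<open>v = S_mat A \<beta> g *v w\<close> turns the form of the inverse at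
  \<open>v\<close> into that of \<open>S_mat A \<beta> g\<close> at \<open>w\<close>.\<close>

lemma matrix_inv_S_mat_pos_def:
  fixes A :: "real ^ 'n ^ 'm"
  assumes "\<beta> > 0" "g \<in> pos_orthant" "v \<noteq> 0"
  shows "v \<bullet> (matrix_inv (S_mat A \<beta> g) *v v) > 0"
proof -
  define w where "w = matrix_inv (S_mat A \<beta> g) *v v"
  have v: "S_mat A \<beta> g *v w = v"
    by (simp add: w_def matrix_vector_mul_assoc S_mat_mult_matrix_inv [OF assms(1,2)])
  with assms(3) have "w \<noteq> 0"
    by auto
  from S_mat_pos_def [OF assms(1,2) this, of A] v show ?thesis
    by (simp add: w_def inner_commute)
qed

text \<open>For positive \<open>g\<close> and \<open>\<beta>\<close> this is the partial derivative
  of \<open>ln (det (S_mat A \<beta> g))\<close> in \<open>g $ i\<close>.\<close>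

definition slope :: "real ^ 'n ^ 'm \<Rightarrow> real \<Rightarrow> real ^ 'n \<Rightarrow> 'n \<Rightarrow> real" where
  "slope A \<beta> g i = column i A \<bullet> (matrix_inv (S_mat A \<beta> g) *v column i A)"

lemma \<Sigma>_mat_diagonal: "\<Sigma>_mat A \<beta> g $ i $ i = g $ i - (g $ i)\<^sup>2 * slope A \<beta> g i"
proof -
  have "diag_mat g ** transpose A ** matrix_inv (S_mat A \<beta> g) ** A ** diag_mat g
      = diag_mat g ** (transpose A ** matrix_inv (S_mat A \<beta> g) ** A) ** diag_mat g"
    by (simp add: matrix_mul_assoc)
  moreover have "diag_mat g $ i $ i = g $ i"
    by (simp add: diag_mat_def)
  ultimately show ?thesis
    by (simp add: \<Sigma>_mat_def slope_def mult_diag_mat_nth diag_mat_mult_nth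
        transpose_mult_mult_nth power2_eq_square)
qed

lemma slope_pos:
  assumes "\<beta> > 0" "g \<in> pos_orthant" "\<mu>_vec A y \<beta> g $ i \<noteq> 0"
  shows "slope A \<beta> g i > 0"
proof -
  \<comment> \<open>The entry vanishes together with column \<open>i\<close>. The simp rule
    \<open>transpose_matrix_vector\<close> is removed because it would rewrite the product that
    \<open>transpose_mult_vec_nth\<close> has to match.\<close>
  have "\<mu>_vec A y \<beta> g $ i = g $ i * (column i A \<bullet> (matrix_inv (S_mat A \<beta> g) *v y))"
    by (simp add: \<mu>_vec_def matrix_vector_mul_assoc [symmetric] diag_mat_mult_vec_nth
        transpose_mult_vec_nth del: transpose_matrix_vector)
  with assms(3) have "column i A \<noteq> 0"
    by auto
  with assms(1,2) show ?thesis
    unfolding slope_def by (rule matrix_inv_S_mat_pos_def)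
qed

text \<open>A known strict minimizer reduces the predicate to an equation, which is what the step
  equivalence compares with the CB update.\<close>

lemma is_unique_arg_min_on_iff:
  assumes "s \<in> D" "\<And>z. z \<in> D \<Longrightarrow> z \<noteq> s \<Longrightarrow> f s < f z"
  shows "is_unique_arg_min_on f D h \<longleftrightarrow> h = s"
proof -
  have "is_arg_min f (\<lambda>z. z \<in> D) z \<longleftrightarrow> z = s" for z
    using assms unfolding is_arg_min_def by (metis less_asym)
  then show ?thesis
    by (auto simp: is_unique_arg_min_on_def)
qed

text \<open>Completing the square with \<open>c = q * s\<^sup>2\<close>. The explicit gap gives
  strict global minimality at \<open>s\<close> without calculus.\<close>

lemma divide_plus_linear_gap:
  fixes c q t :: real
  assumes "c > 0" "q > 0" "t > 0"
  defines "s \<equiv> sqrt (c / q)"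
  shows "c / t + q * t - (c / s + q * s) = q * (t - s)\<^sup>2 / t"
proof -
  have s: "s > 0" "c = q * s\<^sup>2"
    using assms by (simp_all add: s_def)
  then show ?thesis
    using \<open>t > 0\<close> by (simp add: field_simps power2_eq_square)
qed

lemma sum_divide_plus_linear_less:
  fixes c q :: "'n::finite \<Rightarrow> real" and z s :: "real ^ 'n"
  assumes "\<And>i. c i > 0" "\<And>i. q i > 0"
    and s: "\<And>i. s $ i = sqrt (c i / q i)"
    and z: "z \<in> pos_orthant" "z \<noteq> s"
  shows "(\<Sum>i\<in>UNIV. c i / s $ i + q i * s $ i) < (\<Sum>i\<in>UNIV. c i / z $ i + q i * z $ i)"
proof -
  have pos: "z $ i > 0" for i
    using z by (simp add: pos_orthant_def)
  have gap: "c i / z $ i + q i * z $ i - (c i / s $ i + q i * s $ i)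
      = q i * (z $ i - s $ i)\<^sup>2 / z $ i" for i
    unfolding s by (intro divide_plus_linear_gap assms pos)
  obtain j where j: "z $ j \<noteq> s $ j"
    using z(2) by (auto simp: vec_eq_iff)
  show ?thesis
  proof (rule sum_strict_mono_ex1)
    have "q i * (z $ i - s $ i)\<^sup>2 / z $ i \<ge> 0" for i
      using assms(2) [of i] pos [of i] by simp
    then show "\<forall>i\<in>UNIV. c i / s $ i + q i * s $ i \<le> c i / z $ i + q i * z $ i"
      using gap by (metis diff_ge_0_iff_ge)
    have "q j * (z $ j - s $ j)\<^sup>2 / z $ j > 0"
      using assms(2) [of j] pos [of j] j by simp
    then show "\<exists>i\<in>UNIV. c i / s $ i + q i * s $ i < c i / z $ i + q i * z $ i"
      using gap by (metis UNIV_I diff_gt_0_iff_gt)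
  qed simp
qed

lemma surrogate_step_iff_CB_step:
  assumes "\<beta> > 0" "g \<in> pos_orthant" "\<And>i. \<mu>_vec A y \<beta> g $ i \<noteq> 0"
  shows "is_unique_arg_min_on (\<lambda>h. F_obj A y \<beta> (\<mu>_vec A y \<beta> g) h + g_CB A \<beta> h g) pos_orthant h
    \<longleftrightarrow> (\<forall>i. h $ i = g $ i * sqrt ((\<mu>_vec A y \<beta> g $ i)\<^sup>2 / (g $ i - \<Sigma>_mat A \<beta> g $ i $ i)))"
proof -
  define x where "x = \<mu>_vec A y \<beta> g"
  define q where "q = slope A \<beta> g"
  define s :: "real ^ 'a" where "s = (\<chi> i. sqrt ((x $ i)\<^sup>2 / q i))"
  have g: "g $ i > 0" for i
    using assms(2) by (simp add: pos_orthant_def)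
  have q: "q i > 0" for i
    unfolding q_def by (rule slope_pos) (use assms in auto)
  have x: "(x $ i)\<^sup>2 > 0" for i
    using assms(3) by (simp add: x_def)
  have "inverse (g $ i) - inverse ((g $ i)\<^sup>2) * \<Sigma>_mat A \<beta> g $ i $ i = q i" for i
    using g [of i] by (simp add: \<Sigma>_mat_diagonal q_def field_simps power2_eq_square)
  then have "g_CB A \<beta> z g = ln (det (S_mat A \<beta> g)) + (\<Sum>i\<in>UNIV. q i * (z $ i - g $ i))" for z
    by (simp add: g_CB_def)
  then have objective: "F_obj A y \<beta> x z + g_CB A \<beta> z g
      = \<beta> * (norm (A *v x - y))\<^sup>2 + ln (det (S_mat A \<beta> g)) - (\<Sum>i\<in>UNIV. q i * g $ i)
        + (\<Sum>i\<in>UNIV. (x $ i)\<^sup>2 / z $ i + q i * z $ i)" for z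
    by (simp add: F_obj_def sum.distrib sum_subtractf right_diff_distrib)
  \<comment> \<open>A zero entry of \<open>x\<close> would put \<open>s\<close> on the boundary,
    outside the open orthant.\<close>
  have "s \<in> pos_orthant"
    using x q by (simp add: pos_orthant_def s_def)
  then have "is_unique_arg_min_on (\<lambda>h. F_obj A y \<beta> x h + g_CB A \<beta> h g) pos_orthant h \<longleftrightarrow> h = s"
  proof (rule is_unique_arg_min_on_iff)
    fix z :: "real ^ 'a"
    assume "z \<in> pos_orthant" "z \<noteq> s"
    then have "(\<Sum>i\<in>UNIV. (x $ i)\<^sup>2 / s $ i + q i * s $ i)
        < (\<Sum>i\<in>UNIV. (x $ i)\<^sup>2 / z $ i + q i * z $ i)"
      by (intro sum_divide_plus_linear_less x q) (simp_all add: s_def)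
    then show "F_obj A y \<beta> x s + g_CB A \<beta> s g < F_obj A y \<beta> x z + g_CB A \<beta> z g"
      by (simp add: objective)
  qed
  \<comment> \<open>The denominator is \<open>(g $ i)\<^sup>2 * q i\<close>, so the outer factor
    \<open>g $ i\<close> cancels against its root.\<close>
  moreover have "g $ i * sqrt ((x $ i)\<^sup>2 / (g $ i - \<Sigma>_mat A \<beta> g $ i $ i)) = s $ i" for i
    using g [of i] by (simp add: \<Sigma>_mat_diagonal s_def q_def real_sqrt_mult real_sqrt_divide)
  ultimately show ?thesis
    by (simp add: x_def vec_eq_iff)
qed

theorem proposition3p4:
  fixes A :: "real ^ 'n ^ 'm" and y :: "real ^ 'm" and \<beta> :: real
    and \<gamma> :: "nat \<Rightarrow> real ^ 'n"
  assumes "\<beta> > 0"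
    and "\<And>k. \<gamma> k \<in> pos_orthant"
    and "\<And>k i. \<mu>_vec A y \<beta> (\<gamma> k) $ i \<noteq> 0"
  shows "(surrogate_iteration A y \<beta> \<gamma> \<longleftrightarrow> CB_iteration A y \<beta> \<gamma>)
    \<and> (\<forall>\<delta>. \<delta> 0 = \<gamma> 0 \<longrightarrow>
          (surrogate_iteration A y \<beta> \<gamma> \<and> CB_iteration A y \<beta> \<delta>
           \<or> CB_iteration A y \<beta> \<gamma> \<and> surrogate_iteration A y \<beta> \<delta>) \<longrightarrow> \<delta> = \<gamma>)"
proof -
  note step = surrogate_step_iff_CB_step [OF assms]
  have equiv: "surrogate_iteration A y \<beta> \<gamma> \<longleftrightarrow> CB_iteration A y \<beta> \<gamma>"
    by (simp add: surrogate_iteration_def CB_iteration_def step)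
  \<comment> \<open>By \<open>equiv\<close>, both cases of the disjunction provide the CB recursion
    for \<open>\<gamma>\<close>, so one induction serves for either recursion of
    \<open>\<delta>\<close>.\<close>
  moreover have "\<delta> = \<gamma>"
    if init: "\<delta> 0 = \<gamma> 0" and \<gamma>: "CB_iteration A y \<beta> \<gamma>"
      and \<delta>: "CB_iteration A y \<beta> \<delta> \<or> surrogate_iteration A y \<beta> \<delta>" for \<delta>
  proof
    fix k
    show "\<delta> k = \<gamma> k"
    proof (induction k)
      case 0
      show ?case by (rule init)
    next
      case (Suc k)
      \<comment> \<open>Positivity is known for \<open>\<gamma>\<close> only, so the step equivalence is applied to \<open>\<delta> k\<close>
        after replacing it by \<open>\<gamma> k\<close>.\<close>
      from \<delta> have "\<forall>i. \<delta> (Suc k) $ i = \<gamma> k $ i * sqrt ((\<mu>_vec A y \<beta> (\<gamma> k) $ i)\<^sup>2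
          / (\<gamma> k $ i - \<Sigma>_mat A \<beta> (\<gamma> k) $ i $ i))"
      proof
        assume "CB_iteration A y \<beta> \<delta>"
        then show ?thesis
          unfolding CB_iteration_def Suc.IH [symmetric] by blast
      next
        assume "surrogate_iteration A y \<beta> \<delta>"
        then show ?thesis
          unfolding step [symmetric]
          unfolding surrogate_iteration_def Suc.IH [symmetric] by blast
      qed
      with \<gamma> show ?case
        by (simp add: CB_iteration_def vec_eq_iff)
    qed
  qed
  ultimately show ?thesis by blast
qed

end
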